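(* Let $G$ be a hyperbolic group and let $X$ be any finite generating set of $G$. Then $\mathrm{UConjGeo}_X(G)$ is a regular language.
   Context: $\tilde X=X\cup X^{-1}$, $\tilde X^*$ is the free monoid on $\tilde X$, $\ell(w)$ is the length of a word $w$, and $\pi\colon\tilde X^*\to G$ is the canonical surjective homomorphism. A word $w\in\tilde X^*$ is a geodesic if $\ell(w)\le\ell(u)$ for every $u\in\tilde X^*$ with $u\pi=w\pi$; $\mathrm{Geo}_X(G)$ is the set of all geodesics. $\mathrm{UConj}$ is the equivalence relation on $G$ defined by: $(g,h)\in\mathrm{UConj}$ iff $g=h$, or both $g$ and $h$ have a conjugacy class with more than one element (i.e. both are noncentral). $\mathrm{UConjGeo}_X(G)=\{w\in\mathrm{Geo}_X(G):\ell(w)\le\ell(u)\text{ for all }u\in\mathrm{Geo}_X(G)\text{ with }(w\pi,u\pi)\in\mathrm{UConj}\}$. "Hyperbolic" means hyperbolic in the sense of Gromov. *)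

theory Defs
  imports Complex_Main "HOL-Algebra.Generated_Groups"
begin

text \<open>
  Letters are group elements: the alphabet is the subset of \<open>G\<close> formed by \<open>X\<close> and
  the inverses of its elements, so an involution contributes a single letter.
\<close>

definition sym_gens :: "('a, 'b) monoid_scheme \<Rightarrow> 'a set \<Rightarrow> 'a set" where
  "sym_gens G X = X \<union> (\<lambda>x. inv\<^bsub>G\<^esub> x) ` X"

definition word_val :: "('a, 'b) monoid_scheme \<Rightarrow> 'a list \<Rightarrow> 'a" where
  "word_val G w = foldr (\<otimes>\<^bsub>G\<^esub>) w \<one>\<^bsub>G\<^esub>"

definition finite_generating_set :: "('a, 'b) monoid_scheme \<Rightarrow> 'a set \<Rightarrow> bool" where
  "finite_generating_set G X \<longleftrightarrow>
     finite X \<and> X \<subseteq> carrier G \<and> generate G X = carrier G"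

definition Geo :: "('a, 'b) monoid_scheme \<Rightarrow> 'a set \<Rightarrow> 'a list set" where
  "Geo G X = {w \<in> lists (sym_gens G X).
     \<forall>u \<in> lists (sym_gens G X). word_val G u = word_val G w \<longrightarrow> length w \<le> length u}"

definition word_metric :: "('a, 'b) monoid_scheme \<Rightarrow> 'a set \<Rightarrow> 'a \<Rightarrow> 'a \<Rightarrow> real" where
  "word_metric G X g h =
     real (LEAST n. \<exists>w \<in> lists (sym_gens G X).
             length w = n \<and> word_val G w = inv\<^bsub>G\<^esub> g \<otimes>\<^bsub>G\<^esub> h)"

definition gromov_product :: "('a \<Rightarrow> 'a \<Rightarrow> real) \<Rightarrow> 'a \<Rightarrow> 'a \<Rightarrow> 'a \<Rightarrow> real" where
  "gromov_product d e x y = (d e x + d e y - d x y) / 2"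

definition gromov_hyperbolic :: "'a set \<Rightarrow> ('a \<Rightarrow> 'a \<Rightarrow> real) \<Rightarrow> bool" where
  "gromov_hyperbolic M d \<longleftrightarrow>
     (\<exists>\<delta>. \<forall>e\<in>M. \<forall>x\<in>M. \<forall>y\<in>M. \<forall>z\<in>M.
        gromov_product d e x z \<ge>
          min (gromov_product d e x y) (gromov_product d e y z) - \<delta>)"

text \<open>
  Gromov's definition asks for hyperbolicity of the word metric of \<^emph>\<open>some\<close> finite
  generating set; that every finite generating set then works is a theorem.
\<close>

definition hyperbolic_group :: "('a, 'b) monoid_scheme \<Rightarrow> bool" where
  "hyperbolic_group G \<longleftrightarrow>
     group G \<and> (\<exists>Y. finite_generating_set G Y \<and>
                     gromov_hyperbolic (carrier G) (word_metric G Y))"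

definition conj_class :: "('a, 'b) monoid_scheme \<Rightarrow> 'a \<Rightarrow> 'a set" where
  "conj_class G g = {x \<otimes>\<^bsub>G\<^esub> g \<otimes>\<^bsub>G\<^esub> inv\<^bsub>G\<^esub> x | x. x \<in> carrier G}"

text \<open>
  The condition \<open>card C > 1\<close> would be wrong below: conjugacy classes may be infinite,
  and infinite sets have cardinality \<open>0\<close>.
\<close>

definition has_several_conjugates :: "('a, 'b) monoid_scheme \<Rightarrow> 'a \<Rightarrow> bool" where
  "has_several_conjugates G g \<longleftrightarrow> (\<exists>a \<in> conj_class G g. \<exists>b \<in> conj_class G g. a \<noteq> b)"

definition UConj :: "('a, 'b) monoid_scheme \<Rightarrow> ('a \<times> 'a) set" where
  "UConj G = {(g, h). g \<in> carrier G \<and> h \<in> carrier G \<and>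
     (g = h \<or> has_several_conjugates G g \<and> has_several_conjugates G h)}"

definition UConjGeo :: "('a, 'b) monoid_scheme \<Rightarrow> 'a set \<Rightarrow> 'a list set" where
  "UConjGeo G X = {w \<in> Geo G X.
     \<forall>u \<in> Geo G X. (word_val G w, word_val G u) \<in> UConj G \<longrightarrow> length w \<le> length u}"

text \<open>
  Acceptance by a complete deterministic finite automaton over the finite alphabet \<open>A\<close>.
  Taking states to be natural numbers is no restriction, since finite state sets can be
  renamed.
\<close>

definition regular_language :: "'a set \<Rightarrow> 'a list set \<Rightarrow> bool" where
  "regular_language A L \<longleftrightarrow> finite A \<and>
     (\<exists>(Q :: nat set) q0 step F.
        finite Q \<and> q0 \<in> Q \<and> F \<subseteq> Q \<and> (\<forall>q \<in> Q. \<forall>a \<in> A. step q a \<in> Q) \<and>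
        L = {w \<in> lists A. foldl step q0 w \<in> F})"

end

theory Submission
  imports Defs
begin

text \<open>
  If some element is noncentral, then so is some generator, so the words of the language that
  have length at least two are exactly the geodesics of central elements. That language has
  finitely many residuals: whether \<open>u v\<close> is a geodesic of a central element depends only on
  \<open>v\<close>, on the cone type of \<open>u\<close>, and on the conjugates of the generators \<open>x\<close> by \<open>u\<close>.
  If \<open>u v\<close> is a central geodesic, then \<open>u v\<close> and its translate by \<open>x\<close> end at distance at most
  one, so they fellow travel and the conjugates lie in a fixed ball. There are finitely many cone
  types by Cannon's argument.

  Hyperbolicity is only given for some other generating set \<open>Y\<close>. Geodesics over \<open>X\<close> are
  quasi-geodesics over \<open>Y\<close>, so they fellow travel by the stability of quasi-geodesics.
\<close>

section \<open>Stability of quasi-geodesics\<close>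

text \<open>In the intended model the points are group elements, without the edges of a Cayley
  graph, so geodesics have integer parameters. \<open>\<delta>\<close> is positive because distances
  are later divided by it.\<close>

locale discrete_hyperbolic_space =
  fixes M :: "'a set" and d :: "'a \<Rightarrow> 'a \<Rightarrow> real" and \<delta> :: real
  assumes nonneg [simp]: "0 \<le> d x y"
    and dist_self [simp]: "x \<in> M \<Longrightarrow> d x x = 0"
    and commute: "\<lbrakk>x \<in> M; y \<in> M\<rbrakk> \<Longrightarrow> d x y = d y x"
    and triangle: "\<lbrakk>x \<in> M; y \<in> M; z \<in> M\<rbrakk> \<Longrightarrow> d x z \<le> d x y + d y z"
    and delta_pos: "0 < \<delta>"
    and four_point: "\<lbrakk>e \<in> M; x \<in> M; y \<in> M; z \<in> M\<rbrakk> \<Longrightarrow>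
      min (gromov_product d e x y) (gromov_product d e y z) - \<delta> \<le> gromov_product d e x z"
    and discrete_geodesic: "\<lbrakk>x \<in> M; y \<in> M\<rbrakk> \<Longrightarrow> \<exists>g n. g (0::nat) = x \<and> g n = y \<and> g ` {..n} \<subseteq> M \<and>
      (\<forall>i\<le>n. \<forall>j\<le>n. d (g i) (g j) = \<bar>real i - real j\<bar>)"
begin

text \<open>The upper bound is demanded of consecutive points only, as the triangle inequality
  extends it to all pairs. The lower bound is solved for the difference of the parameters, the form
  in which it gets used.\<close>

definition quasi_geodesic :: "real \<Rightarrow> real \<Rightarrow> real \<Rightarrow> (nat \<Rightarrow> 'a) \<Rightarrow> nat \<Rightarrow> bool" where
  "quasi_geodesic K l c f N \<longleftrightarrow> f ` {..N} \<subseteq> M \<and>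
     (\<forall>i<N. d (f i) (f (Suc i)) \<le> K) \<and>
     (\<forall>i\<le>N. \<forall>j\<le>N. \<bar>real i - real j\<bar> \<le> l * d (f i) (f j) + c)"

text \<open>Halving a chain of at most \<open>2 ^ m\<close> steps costs one \<open>\<delta>\<close>
  per level, so the loss is only logarithmic in the number of steps.\<close>

lemma gromov_product_chain:
  assumes "e \<in> M" "f ` {a..a + n} \<subseteq> M" "1 \<le> n" "n \<le> 2 ^ m"
    and "\<And>i. \<lbrakk>a \<le> i; i < a + n\<rbrakk> \<Longrightarrow> t \<le> gromov_product d e (f i) (f (Suc i))"
  shows "t - real m * \<delta> \<le> gromov_product d e (f a) (f (a + n))"
  using assms(2-)
proof (induction m arbitrary: a n)
  case 0
  then have "n = 1" by simp
  with 0(4)[of a] show ?case by simp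
next
  case (Suc m)
  show ?case
  proof (cases "n \<le> 2 ^ m")
    case True
    from Suc.IH[OF Suc.prems(1,2) True Suc.prems(4)] delta_pos show ?thesis
      by (simp add: algebra_simps)
  next
    case False
    \<comment> \<open>The first piece has exactly \<open>2 ^ m\<close> steps, so the remainder is
      nonempty and no longer.\<close>
    define k where "k = (2::nat) ^ m"
    have k: "k < n" "1 \<le> k" "n - k \<le> 2 ^ m" using False Suc.prems(3) by (auto simp: k_def)
    have "t - real m * \<delta> \<le> gromov_product d e (f a) (f (a + k))"
      using k Suc.prems(1) by (intro Suc.IH Suc.prems(4)) (auto simp: k_def)
    moreover have "t - real m * \<delta> \<le> gromov_product d e (f (a + k)) (f (a + k + (n - k)))"
      using k Suc.prems(1) by (intro Suc.IH Suc.prems(4)) auto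
    moreover have "f a \<in> M" "f (a + k) \<in> M" "f (a + n) \<in> M" using k Suc.prems(1) by auto
    ultimately show ?thesis
      using four_point[OF assms(1), of "f a" "f (a + k)" "f (a + n)"] k
      by (simp add: algebra_simps)
  qed
qed

text \<open>A step of length at most \<open>K\<close> between points at distance at least
  \<open>D\<close> from \<open>e\<close> has product at least \<open>D - K / 2\<close>; chaining the
  steps costs \<open>m\<close> times \<open>\<delta>\<close>.\<close>

lemma gromov_product_path:
  assumes e: "e \<in> M" and f: "f ` {i..j} \<subseteq> M" and ij: "i \<le> j" "j - i \<le> 2 ^ m"
    and K: "0 \<le> K" "\<And>k. \<lbrakk>i \<le> k; k < j\<rbrakk> \<Longrightarrow> d (f k) (f (Suc k)) \<le> K"
    and D: "\<And>k. \<lbrakk>i \<le> k; k \<le> j\<rbrakk> \<Longrightarrow> D \<le> d e (f k)"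
  shows "D - K - real m * \<delta> \<le> gromov_product d e (f i) (f j)"
proof (cases "i = j")
  case True
  have "0 \<le> real m * \<delta>" using delta_pos by simp
  with True D[of i] K(1) f show ?thesis by (simp add: gromov_product_def)
next
  case False
  have "D - K \<le> gromov_product d e (f k) (f (Suc k))" if "i \<le> k" "k < j" for k
    using K(1) K(2)[OF that] D[of k] D[of "Suc k"] that by (simp add: gromov_product_def)
  with gromov_product_chain[OF e, of f i "j - i" m "D - K"] f ij False show ?thesis by simp
qed

lemma gromov_product_commute: "\<lbrakk>x \<in> M; y \<in> M\<rbrakk> \<Longrightarrow> gromov_product d e x y = gromov_product d e y x"
  by (simp add: gromov_product_def commute)

text \<open>Choosing \<open>m\<close> logarithmic in \<open>D\<close> turns the conclusion into a bound on \<open>D\<close>.\<close>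
lemma geodesic_near_quasi_geodesic_aux:
  assumes g: "g (0::nat) = f 0" "g n = f N" "g ` {..n} \<subseteq> M"
    "\<And>i j. \<lbrakk>i \<le> n; j \<le> n\<rbrakk> \<Longrightarrow> d (g i) (g j) = \<bar>real i - real j\<bar>"
    and f: "quasi_geodesic K l c f N" and K: "0 \<le> K" and l: "0 \<le> l"
    and near: "\<And>t. t \<le> n \<Longrightarrow> \<exists>i\<le>N. d (g t) (f i) \<le> D"
    and t0: "t0 \<le> n" and far: "\<And>i. i \<le> N \<Longrightarrow> D \<le> d (g t0) (f i)"
    and m: "l * (6 * D + 2) + c \<le> 2 ^ m"
  shows "D \<le> K + (real m + 2) * \<delta>"
proof -
  let ?e = "g t0"
  have fM: "f i \<in> M" if "i \<le> N" for i using f that by (auto simp: quasi_geodesic_def)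
  have gM: "g i \<in> M" if "i \<le> n" for i using g(3) that by auto
  have D0: "0 \<le> D" using near[OF t0] nonneg order_trans by blast
  have eM: "?e \<in> M" using gM t0 by simp
  \<comment> \<open>From \<open>g t0\<close> one goes about \<open>2 * D\<close> both ways, clipped
    at the ends of the geodesic (natural subtraction clips at 0). A path point within
    \<open>D\<close> of an unclipped target has product at least \<open>(2 * D + D - D) / 2\<close>
    with it; a clipped target is itself an end of the path, at distance at least \<open>D\<close>
    from \<open>g t0\<close>.\<close>
  define s where "s = nat \<lceil>2 * D\<rceil>"
  have s: "2 * D \<le> real s" "real s \<le> 2 * D + 1" using D0 unfolding s_def by linarith+
  define y z where "y = t0 - s" and "z = min (t0 + s) n"
  have yz: "y \<le> t0" "t0 \<le> z" "z \<le> n" using t0 by (auto simp: y_def z_def)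
  have "\<exists>i\<le>N. d (g y) (f i) \<le> D \<and> D \<le> gromov_product d ?e (g y) (f i)"
  proof (cases "s \<le> t0")
    case True
    from near[of y] yz obtain i where i: "i \<le> N" "d (g y) (f i) \<le> D" by auto
    have "d ?e (g y) = real s" using g(4)[of t0 y] yz True by (simp add: y_def of_nat_diff)
    then show ?thesis using i s far[of i] by (intro exI[of _ i]) (simp add: gromov_product_def)
  next
    case False
    then have "g y = f 0" using g(1) by (simp add: y_def)
    then show ?thesis using D0 far[of 0] fM by (intro exI[of _ 0]) (simp add: gromov_product_def)
  qed
  then obtain i where i: "i \<le> N" "d (g y) (f i) \<le> D" "D \<le> gromov_product d ?e (g y) (f i)" by auto
  have "\<exists>i\<le>N. d (g z) (f i) \<le> D \<and> D \<le> gromov_product d ?e (g z) (f i)"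
  proof (cases "t0 + s \<le> n")
    case True
    from near[of z] yz obtain i where i: "i \<le> N" "d (g z) (f i) \<le> D" by auto
    have "d ?e (g z) = real s" using g(4)[of t0 z] yz True by (simp add: z_def)
    then show ?thesis using i s far[of i] by (intro exI[of _ i]) (simp add: gromov_product_def)
  next
    case False
    then have "g z = f N" using g(2) by (simp add: z_def)
    then show ?thesis using D0 far[of N] fM by (intro exI[of _ N]) (simp add: gromov_product_def)
  qed
  then obtain j where j: "j \<le> N" "d (g z) (f j) \<le> D" "D \<le> gromov_product d ?e (g z) (f j)" by auto
  have M: "g y \<in> M" "g z \<in> M" "f i \<in> M" "f j \<in> M" using gM fM yz i j by auto
  have "d (g y) (g z) \<le> 2 * real s" using g(4)[of y z] yz by (simp add: y_def z_def)
  \<comment> \<open>The sum \<open>D + 2 * s + D\<close>, where \<open>s\<close> is at most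
    \<open>2 * D + 1\<close>.\<close>
  then have "d (f i) (f j) \<le> 6 * D + 2"
    using triangle[OF M(3,1,4)] triangle[OF M(1,2,4)] i(2) j(2) s commute[OF M(3,1)] by simp
  then have "l * d (f i) (f j) + c \<le> 2 ^ m"
    using m l mult_left_mono[of "d (f i) (f j)" "6 * D + 2" l] by linarith
  then have ij: "\<bar>real i - real j\<bar> \<le> 2 ^ m"
    using f i(1) j(1) unfolding quasi_geodesic_def by (meson order_trans)
  \<comment> \<open>The path between \<open>f i\<close> and \<open>f j\<close> has at most
    \<open>2 ^ m\<close> steps and stays at distance at least \<open>D\<close> from
    \<open>g t0\<close>.\<close>
  have "D - K - real m * \<delta> \<le> gromov_product d ?e (f i) (f j)"
  proof -
    have path: "D - K - real m * \<delta> \<le> gromov_product d ?e (f a) (f b)"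
      if "a \<le> b" "b \<le> N" "\<bar>real a - real b\<bar> \<le> 2 ^ m" for a b
    proof (rule gromov_product_path[OF eM _ that(1) _ K])
      have "real (b - a) \<le> real (2 ^ m)" using that by (simp add: of_nat_diff)
      then show "b - a \<le> 2 ^ m" by (simp only: of_nat_le_iff)
    qed (use that far f fM in \<open>auto simp: quasi_geodesic_def\<close>)
    show ?thesis
    proof (cases "i \<le> j")
      case True
      then show ?thesis using path ij j by simp
    next
      case False
      then show ?thesis using path[of j i] ij i
        by (simp add: gromov_product_commute[OF M(3,4)] abs_minus_commute)
    qed
  qed
  moreover have "0 \<le> real m * \<delta>" "(real m + 2) * \<delta> = real m * \<delta> + 2 * \<delta>"
    using delta_pos by (simp_all add: algebra_simps)
  \<comment> \<open>\<open>g t0\<close> lies on a geodesic between these points, so the product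
    vanishes. Passing through \<open>f i\<close> and \<open>f j\<close> uses the four-point
    condition twice, whence the summand \<open>2 * \<delta>\<close> in the bound.\<close>
  moreover have "gromov_product d ?e (g y) (g z) = 0"
    using g(4)[of t0 y] g(4)[of t0 z] g(4)[of y z] yz by (simp add: gromov_product_def)
  ultimately show ?thesis
    using four_point[OF eM M(1,3,2)] four_point[OF eM M(3,4,2)] i(3) j(3) K delta_pos
      gromov_product_commute[OF M(2,4), of ?e]
    by linarith
qed

text \<open>Let \<open>D\<close> be the largest distance from the geodesic to the path. If it
  exceeded a threshold, then an \<open>m\<close> with \<open>D\<close> just above
  \<open>K + (m + 2) * \<delta>\<close> would be so large that \<open>2 ^ m\<close> beats a linear
  function of \<open>m\<close>, and the preceding estimate would be contradicted.\<close>

lemma geodesic_near_quasi_geodesic: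
  assumes K: "0 \<le> K" and l: "0 \<le> l" and c: "0 \<le> c"
  obtains H where "0 \<le> H"
    "\<And>f N g n t. \<lbrakk>quasi_geodesic K l c f N; g (0::nat) = f 0; g n = f N; g ` {..n} \<subseteq> M;
       \<And>i j. \<lbrakk>i \<le> n; j \<le> n\<rbrakk> \<Longrightarrow> d (g i) (g j) = \<bar>real i - real j\<bar>; t \<le> n\<rbrakk> \<Longrightarrow>
       \<exists>i\<le>N. d (g t) (f i) \<le> H"
proof -
  define R where "R m = K + (real m + 3) * \<delta>" for m
  have "\<exists>m0. \<forall>m\<ge>m0. l * (6 * R m + 2) + c \<le> 2 ^ m"
  proof -
    \<comment> \<open>Expanded in \<open>m\<close>, the left side is
      \<open>A * m + B\<close>.\<close>
    define A B where "A = 6 * l * \<delta>" and "B = l * (6 * K + 18 * \<delta> + 2) + c"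
    have "(\<lambda>m. real m / 2 ^ m) \<longlonglongrightarrow> 0" "(\<lambda>m. 1 / 2 ^ m :: real) \<longlonglongrightarrow> 0"
      using lim_n_over_pown[of "2::real"] LIMSEQ_divide_realpow_zero[of 2 1] by auto
    then have "(\<lambda>m. A * (real m / 2 ^ m) + B * (1 / 2 ^ m)) \<longlonglongrightarrow> A * 0 + B * 0"
      by (intro tendsto_intros)
    then have "\<forall>\<^sub>F m in sequentially. A * (real m / 2 ^ m) + B * (1 / 2 ^ m) < 1"
      by (intro order_tendstoD(2)) auto
    then obtain m0 where m0: "\<And>m. m \<ge> m0 \<Longrightarrow> A * (real m / 2 ^ m) + B * (1 / 2 ^ m) < 1"
      by (auto simp: eventually_sequentially)
    have "l * (6 * R m + 2) + c \<le> 2 ^ m" if "m \<ge> m0" for m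
    proof -
      have "(A * real m + B) / 2 ^ m < 1" using m0[OF that] by (simp add: add_divide_distrib)
      then have "A * real m + B \<le> 2 ^ m" by (simp add: divide_less_eq)
      then show ?thesis by (simp add: A_def B_def R_def algebra_simps)
    qed
    then show ?thesis by blast
  qed
  then obtain m0 where m0: "\<And>m. m \<ge> m0 \<Longrightarrow> l * (6 * R m + 2) + c \<le> 2 ^ m" by blast
  show thesis
  proof
    show "0 \<le> R m0" using K delta_pos by (simp add: R_def)
    fix f N and g :: "nat \<Rightarrow> 'a" and n t
    assume f: "quasi_geodesic K l c f N" and g: "g 0 = f 0" "g n = f N" "g ` {..n} \<subseteq> M"
      "\<And>i j. \<lbrakk>i \<le> n; j \<le> n\<rbrakk> \<Longrightarrow> d (g i) (g j) = \<bar>real i - real j\<bar>" and t: "t \<le> n"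
    define \<rho> where "\<rho> s = Min ((\<lambda>i. d (g s) (f i)) ` {..N})" for s
    define D where "D = Max (\<rho> ` {..n})"
    have att: "\<exists>i\<le>N. d (g s) (f i) = \<rho> s" for s
    proof -
      have "\<rho> s \<in> (\<lambda>i. d (g s) (f i)) ` {..N}" unfolding \<rho>_def by (intro Min_in) auto
      then show ?thesis by auto
    qed
    have le: "\<rho> s \<le> d (g s) (f i)" if "i \<le> N" for s i
      unfolding \<rho>_def using that by (intro Min_le) auto
    have Dle: "\<rho> s \<le> D" if "s \<le> n" for s unfolding D_def using that by (intro Max_ge) auto
    have "D \<in> \<rho> ` {..n}" unfolding D_def by (intro Max_in) auto
    then obtain t0 where t0: "t0 \<le> n" "D = \<rho> t0" by auto
    have near: "\<exists>i\<le>N. d (g s) (f i) \<le> D" if "s \<le> n" for s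
      using att[of s] Dle[OF that] by auto
    have "D \<le> R m0"
    proof (rule ccontr)
      assume *: "\<not> D \<le> R m0"
      \<comment> \<open>Rounding up places \<open>D\<close> above
        \<open>K + (m + 2) * \<delta>\<close> and at most at \<open>R m\<close>, one
        \<open>\<delta>\<close> further.\<close>
      define m where "m = nat (\<lceil>(D - K) / \<delta>\<rceil> - 3)"
      have x: "real m0 + 3 < (D - K) / \<delta>"
        using * delta_pos by (simp add: R_def field_simps)
      then have m: "m \<ge> m0" "(D - K) / \<delta> \<le> real m + 3" "real m + 2 < (D - K) / \<delta>"
        unfolding m_def by linarith+
      then have D: "D \<le> R m" "K + (real m + 2) * \<delta> < D"
        using delta_pos by (simp_all add: R_def field_simps)
      have "l * (6 * D + 2) \<le> l * (6 * R m + 2)" using D l by (intro mult_left_mono) auto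
      with m0[OF m(1)] have "l * (6 * D + 2) + c \<le> 2 ^ m" by linarith
      from geodesic_near_quasi_geodesic_aux[OF g f K l near t0(1) _ this] le t0 D(2)
      show False by fastforce
    qed
    with near[OF t] show "\<exists>i\<le>N. d (g t) (f i) \<le> R m0" by (meson order_trans)
  qed
qed

text \<open>
  Along the geodesic, the nearby points of the quasi-geodesic must jump from before \<open>j\<close>
  to after \<open>j\<close>; the jump is short in the metric, hence short in the parameter.
\<close>
lemma quasi_geodesic_near_geodesic:
  assumes f: "quasi_geodesic K l c f N" and K: "0 \<le> K" and l: "0 \<le> l"
    and g: "g (0::nat) = f 0" "g n = f N" "g ` {..n} \<subseteq> M"
    "\<And>i j. \<lbrakk>i \<le> n; j \<le> n\<rbrakk> \<Longrightarrow> d (g i) (g j) = \<bar>real i - real j\<bar>"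
    and H: "0 \<le> H" "\<And>t. t \<le> n \<Longrightarrow> \<exists>i\<le>N. d (g t) (f i) \<le> H" and j: "j \<le> N"
  shows "\<exists>t\<le>n. d (f j) (g t) \<le> K * (l * (2 * H + 1) + c) + H"
proof -
  have fM: "f i \<in> M" if "i \<le> N" for i using f that by (auto simp: quasi_geodesic_def)
  have gM: "g i \<in> M" if "i \<le> n" for i using g(3) that by auto
  have path: "d (f a) (f (a + k)) \<le> K * real k" if "a + k \<le> N" for a k
    using that
  proof (induction k)
    case 0
    then show ?case using fM by simp
  next
    case (Suc k)
    have "d (f (a + k)) (f (a + Suc k)) \<le> K" using f Suc.prems by (simp add: quasi_geodesic_def)
    moreover have "d (f a) (f (a + Suc k)) \<le> d (f a) (f (a + k)) + d (f (a + k)) (f (a + Suc k))"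
      using Suc.prems fM by (intro triangle) auto
    ultimately show ?case using Suc by (simp add: algebra_simps)
  qed
  have "\<exists>s\<le>n. \<exists>t\<le>n. \<bar>real s - real t\<bar> \<le> 1 \<and> (\<exists>i\<le>j. d (g s) (f i) \<le> H) \<and>
      (\<exists>k\<le>N. j \<le> k \<and> d (g t) (f k) \<le> H)"
  proof -
    define P where "P t \<longleftrightarrow> (\<exists>k\<le>N. j \<le> k \<and> d (g t) (f k) \<le> H)" for t
    have "P n" unfolding P_def using g(2) H(1) j fM by (intro exI[of _ N]) auto
    \<comment> \<open>The first time at which the geodesic is near the path at or after
      \<open>j\<close>; one moment earlier it is near the path before \<open>j\<close>. If the first
      time is 0, the common starting point serves instead.\<close>
    define t where "t = (LEAST t. P t)"
    have t: "P t" "t \<le> n" unfolding t_def using \<open>P n\<close> by (auto intro: LeastI Least_le)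
    show ?thesis
    proof (cases t)
      case 0
      have "d (g 0) (f 0) \<le> H" using g(1) H(1) fM by simp
      then show ?thesis using t 0 unfolding P_def by (intro exI[of _ 0]) auto
    next
      case (Suc s)
      then have "\<not> P s" unfolding t_def using not_less_Least[of s P] by auto
      moreover obtain i where "i \<le> N" "d (g s) (f i) \<le> H" using H(2)[of s] t Suc by auto
      ultimately have "\<exists>i\<le>j. d (g s) (f i) \<le> H" unfolding P_def by (metis nle_le)
      moreover have "s \<le> n" "\<bar>real s - real t\<bar> \<le> 1" using t(2) Suc by auto
      ultimately show ?thesis using t unfolding P_def by blast
    qed
  qed
  then obtain s t i k where st: "s \<le> n" "t \<le> n" "\<bar>real s - real t\<bar> \<le> 1"
    and i: "i \<le> j" "d (g s) (f i) \<le> H" and k: "k \<le> N" "j \<le> k" "d (g t) (f k) \<le> H" by blast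
  have M: "g s \<in> M" "g t \<in> M" "f i \<in> M" "f k \<in> M" "f j \<in> M" using gM fM st i k by auto
  have "d (f i) (f k) \<le> 2 * H + 1"
    using triangle[OF M(3,1,4)] triangle[OF M(1,2,4)] g(4)[OF st(1,2)] st(3) i k
      commute[OF M(3,1)] by simp
  then have "l * d (f i) (f k) + c \<le> l * (2 * H + 1) + c"
    using l by (simp add: mult_left_mono)
  moreover have "\<bar>real i - real k\<bar> \<le> l * d (f i) (f k) + c"
    using f i(1) j k(1) unfolding quasi_geodesic_def by simp
  ultimately have "real (j - i) \<le> l * (2 * H + 1) + c" using i k by (simp add: of_nat_diff)
  then have "K * real (j - i) \<le> K * (l * (2 * H + 1) + c)" using K by (intro mult_left_mono)
  moreover have "d (f i) (f j) \<le> K * real (j - i)" using path[of i "j - i"] i j by simp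
  moreover have "d (f j) (g s) \<le> d (f j) (f i) + d (f i) (g s)" by (rule triangle[OF M(5,3,1)])
  ultimately have "d (f j) (g s) \<le> K * (l * (2 * H + 1) + c) + H"
    using i(2) commute[OF M(5,3)] commute[OF M(3,1)] by linarith
  then show ?thesis using st by blast
qed

text \<open>A geodesic joining the common ends mediates: \<open>f j\<close> is near it, and each of
  its points is near \<open>f'\<close>.\<close>

theorem quasi_geodesics_close:
  assumes K: "0 \<le> K" and l: "0 \<le> l" and c: "0 \<le> c"
  obtains H where "0 \<le> H"
    "\<And>f N f' N' j. \<lbrakk>quasi_geodesic K l c f N; quasi_geodesic K l c f' N'; f 0 = f' 0; f N = f' N';
       j \<le> N\<rbrakk> \<Longrightarrow> \<exists>i\<le>N'. d (f j) (f' i) \<le> H"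
proof -
  obtain H where H0: "0 \<le> H" and H: "\<And>f N g n t. \<lbrakk>quasi_geodesic K l c f N;
       g (0::nat) = f 0; g n = f N; g ` {..n} \<subseteq> M;
       \<And>i j. \<lbrakk>i \<le> n; j \<le> n\<rbrakk> \<Longrightarrow> d (g i) (g j) = \<bar>real i - real j\<bar>; t \<le> n\<rbrakk> \<Longrightarrow>
       \<exists>i\<le>N. d (g t) (f i) \<le> H"
    using geodesic_near_quasi_geodesic[OF assms] by metis
  show thesis
  proof
    show "0 \<le> K * (l * (2 * H + 1) + c) + H + H" using assms H0 by simp
    fix f N f' N' j
    assume f: "quasi_geodesic K l c f N" and f': "quasi_geodesic K l c f' N'"
      and ends: "f 0 = f' 0" "f N = f' N'" and j: "j \<le> N"
    have M: "f i \<in> M" if "i \<le> N" for i using f that by (auto simp: quasi_geodesic_def)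
    have M': "f' i \<in> M" if "i \<le> N'" for i using f' that by (auto simp: quasi_geodesic_def)
    obtain g n where g: "g (0::nat) = f 0" "g n = f N" "g ` {..n} \<subseteq> M"
      "\<And>i j. \<lbrakk>i \<le> n; j \<le> n\<rbrakk> \<Longrightarrow> d (g i) (g j) = \<bar>real i - real j\<bar>"
      using discrete_geodesic[OF M[of 0] M[of N]] by auto
    have H1: "\<And>t. t \<le> n \<Longrightarrow> \<exists>i\<le>N. d (g t) (f i) \<le> H"
      using H[OF f g] by blast
    obtain t where t: "t \<le> n" "d (f j) (g t) \<le> K * (l * (2 * H + 1) + c) + H"
      using quasi_geodesic_near_geodesic[OF f K l g H0 H1 j] by auto
    obtain i where i: "i \<le> N'" "d (g t) (f' i) \<le> H"
      using H[OF f', of g n t] g ends t by auto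
    have "d (f j) (f' i) \<le> d (f j) (g t) + d (g t) (f' i)"
      using M j M' i g(3) t by (intro triangle) auto
    then show "\<exists>i\<le>N'. d (f j) (f' i) \<le> K * (l * (2 * H + 1) + c) + H + H"
      using i t by (intro exI[of _ i]) linarith
  qed
qed

end

section \<open>Finite residuals\<close>

text \<open>The Myhill-Nerode automaton: its states are the residuals, numbered by an injection, and
  the final ones contain the empty word.\<close>

lemma regular_language_if_finite_residuals:
  assumes A: "finite A" and L: "L \<subseteq> lists A"
    and fin: "finite ((\<lambda>u. {v. u @ v \<in> L}) ` lists A)"
  shows "regular_language A L"
proof -
  define R where "R = (\<lambda>u. {v. u @ v \<in> L}) ` lists A"
  obtain f :: "'a list set \<Rightarrow> nat" where f: "inj_on f R"
    using finite_imp_inj_to_nat_seg[OF fin] unfolding R_def by blast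
  define step where "step q a = f {v. a # v \<in> inv_into R f q}" for q a
  define F where "F = {q \<in> f ` R. [] \<in> inv_into R f q}"
  have der: "{v. a # v \<in> P} \<in> R" if "P \<in> R" "a \<in> A" for P a
  proof -
    from that(1) obtain u where u: "u \<in> lists A" "P = {v. u @ v \<in> L}" by (auto simp: R_def)
    have "{v. a # v \<in> P} = {v. (u @ [a]) @ v \<in> L}" using u by simp
    moreover have "u @ [a] \<in> lists A" using u that by simp
    ultimately show ?thesis unfolding R_def by blast
  qed
  have run: "foldl step (f P) w = f {v. w @ v \<in> P} \<and> {v. w @ v \<in> P} \<in> R"
    if "P \<in> R" "w \<in> lists A" for P w
    using that(2,1)
  proof (induction w arbitrary: P rule: lists.induct)
    case Nil
    then show ?case by simp
  next
    case (Cons a w)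
    then show ?case using Cons.IH[OF der] f by (simp add: step_def)
  qed
  have L_R: "L \<in> R" unfolding R_def by (intro image_eqI[of _ _ "[]"]) auto
  have "foldl step (f L) w \<in> F \<longleftrightarrow> w \<in> L" if "w \<in> lists A" for w
    using run[OF L_R that] f by (simp add: F_def)
  then have eq: "L = {w \<in> lists A. foldl step (f L) w \<in> F}" using L by blast
  show ?thesis unfolding regular_language_def
  proof (intro conjI exI)
    show "\<forall>q\<in>f ` R. \<forall>a\<in>A. step q a \<in> f ` R" using der f by (auto simp: step_def)
    show "L = {w \<in> lists A. foldl step (f L) w \<in> F}" by (fact eq)
    show "finite (f ` R)" using fin by (simp add: R_def)
  qed (use A L_R in \<open>auto simp: F_def\<close>)
qed

text \<open>On \<open>U\<close> the function \<open>r\<close> factors through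
  \<open>key\<close>.\<close>

lemma finite_image_if_determined:
  assumes "finite K" "key ` U \<subseteq> K"
    and "\<And>u u'. \<lbrakk>u \<in> U; u' \<in> U; key u = key u'\<rbrakk> \<Longrightarrow> r u = r u'"
  shows "finite (r ` U)"
proof -
  have "r u = r (inv_into U key (key u))" if "u \<in> U" for u
    using that by (intro assms(3)) (auto simp: inv_into_into f_inv_into_f)
  then have "r ` U \<subseteq> (\<lambda>k. r (inv_into U key k)) ` (key ` U)" by (auto simp: image_iff)
  then show ?thesis using assms(1,2) by (meson finite_imageI finite_subset)
qed

section \<open>Word metrics\<close>

text \<open>The distance from the identity, kept a natural number so that it can be compared with
  lengths of lists.\<close>

definition word_length :: "('a, 'b) monoid_scheme \<Rightarrow> 'a set \<Rightarrow> 'a \<Rightarrow> nat" where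
  "word_length G X g = (LEAST n. \<exists>w \<in> lists (sym_gens G X). length w = n \<and> word_val G w = g)"

lemma word_metric_word_length:
  "word_metric G X g h = real (word_length G X (inv\<^bsub>G\<^esub> g \<otimes>\<^bsub>G\<^esub> h))"
  by (simp add: word_metric_def word_length_def)

lemma word_val_Nil [simp]: "word_val G [] = \<one>\<^bsub>G\<^esub>"
  and word_val_Cons [simp]: "word_val G (a # w) = a \<otimes>\<^bsub>G\<^esub> word_val G w"
  by (simp_all add: word_val_def)

text \<open>The generating set is a parameter so that a second one can be interpreted over the same
  group.\<close>

locale finitely_generated_group = group G for G :: "('a, 'b) monoid_scheme" (structure) +
  fixes X :: "'a set"
  assumes fin_gen: "finite_generating_set G X"
begin

abbreviation letters :: "'a set" where "letters \<equiv> sym_gens G X"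
abbreviation val :: "'a list \<Rightarrow> 'a" where "val \<equiv> word_val G"
abbreviation len :: "'a \<Rightarrow> nat" where "len \<equiv> word_length G X"

lemma mult_inv_cancel [simp]:
  assumes "a \<in> carrier G" "b \<in> carrier G"
  shows "a \<otimes> (inv a \<otimes> b) = b" "inv a \<otimes> (a \<otimes> b) = b"
  using assms by (simp_all flip: m_assoc)

section \<open>Words, word length and geodesics\<close>

lemma finite_letters: "finite letters"
  and letters_closed: "letters \<subseteq> carrier G"
  and X_closed: "X \<subseteq> carrier G"
  and inv_letters: "a \<in> letters \<Longrightarrow> inv a \<in> letters"
  using fin_gen by (auto simp: finite_generating_set_def sym_gens_def subset_iff)

lemma val_closed [simp, intro]: "w \<in> lists letters \<Longrightarrow> val w \<in> carrier G"
  using letters_closed by (induction w) auto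

lemma val_append:
  "\<lbrakk>u \<in> lists letters; v \<in> lists letters\<rbrakk> \<Longrightarrow> val (u @ v) = val u \<otimes> val v"
  using letters_closed by (induction u) (auto simp: m_assoc subset_iff)

lemma val_inverse_word:
  "w \<in> lists letters \<Longrightarrow> rev (map (\<lambda>a. inv a) w) \<in> lists letters \<and>
     val (rev (map (\<lambda>a. inv a) w)) = inv (val w)"
proof (induction w)
  case (Cons a w)
  moreover have "a \<in> carrier G" using Cons letters_closed by auto
  moreover have "[inv a] \<in> lists letters" using Cons inv_letters by auto
  ultimately show ?case by (auto simp: val_append inv_mult_group inv_letters)
qed simp

lemma ex_word: "g \<in> carrier G \<Longrightarrow> \<exists>w\<in>lists letters. val w = g"
proof -
  assume "g \<in> carrier G"
  then have "g \<in> generate G X" using fin_gen by (simp add: finite_generating_set_def)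
  then show ?thesis
  proof (induction g rule: generate.induct)
    case one
    show ?case by (rule bexI[of _ "[]"]) auto
  next
    case (incl h)
    then show ?case using X_closed by (intro bexI[of _ "[h]"]) (auto simp: sym_gens_def)
  next
    case (inv h)
    then show ?case using X_closed by (intro bexI[of _ "[inv h]"]) (auto simp: sym_gens_def)
  next
    case (eng g h)
    then obtain u v where "u \<in> lists letters" "v \<in> lists letters" "val u = g" "val v = h" by auto
    then show ?case by (intro bexI[of _ "u @ v"]) (auto simp: val_append)
  qed
qed

lemma ex_shortest_word:
  assumes "g \<in> carrier G"
  shows "\<exists>w\<in>lists letters. val w = g \<and> length w = len g"
proof -
  have "\<exists>n. \<exists>w\<in>lists letters. length w = n \<and> val w = g" using ex_word[OF assms] by auto
  from LeastI_ex[OF this] show ?thesis unfolding word_length_def by auto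
qed

lemma len_val_le: "w \<in> lists letters \<Longrightarrow> len (val w) \<le> length w"
  unfolding word_length_def by (intro Least_le) auto

lemma Geo_iff: "w \<in> Geo G X \<longleftrightarrow> w \<in> lists letters \<and> length w = len (val w)"
proof (intro iffI conjI)
  assume w: "w \<in> Geo G X"
  then show wl: "w \<in> lists letters" by (simp add: Geo_def)
  then obtain u where u: "u \<in> lists letters" "val u = val w" "length u = len (val w)"
    using ex_shortest_word[OF val_closed] by blast
  then have "length w \<le> length u" using w unfolding Geo_def by blast
  then show "length w = len (val w)" using len_val_le[OF wl] u(3) by linarith
next
  assume w: "w \<in> lists letters \<and> length w = len (val w)"
  then show "w \<in> Geo G X" unfolding Geo_def using len_val_le by fastforce
qed

lemma ex_Geo: "g \<in> carrier G \<Longrightarrow> \<exists>w\<in>Geo G X. val w = g \<and> length w = len g"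
  using ex_shortest_word Geo_iff by metis

lemma len_one [simp]: "len \<one> = 0"
  using len_val_le[of "[]"] by simp

lemma len_mult_le:
  assumes "g \<in> carrier G" "h \<in> carrier G"
  shows "len (g \<otimes> h) \<le> len g + len h"
proof -
  obtain u v where "u \<in> lists letters" "val u = g" "length u = len g"
    "v \<in> lists letters" "val v = h" "length v = len h"
    using ex_shortest_word assms by metis
  then show ?thesis using len_val_le[of "u @ v"] by (simp add: val_append)
qed

lemma len_inv_le: "g \<in> carrier G \<Longrightarrow> len (inv g) \<le> len g"
  using ex_shortest_word[of g] val_inverse_word len_val_le by (metis length_map length_rev)

lemma len_inv [simp]: "g \<in> carrier G \<Longrightarrow> len (inv g) = len g"
  using len_inv_le[of g] len_inv_le[of "inv g"] by simp

lemma len_X_le: "x \<in> X \<Longrightarrow> len x \<le> 1"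
  using len_val_le[of "[x]"] X_closed by (auto simp: sym_gens_def)

text \<open>Lengths add under concatenation while \<open>len\<close> is subadditive, so a shortcut
  for a factor would shorten the whole word.\<close>

lemma Geo_append:
  assumes "u @ v \<in> Geo G X"
  shows "u \<in> Geo G X" "v \<in> Geo G X"
proof -
  have uv: "u \<in> lists letters" "v \<in> lists letters" using assms by (auto simp: Geo_iff)
  then have "length u + length v \<le> len (val u) + len (val v)"
    using assms len_mult_le[of "val u" "val v"] by (auto simp: Geo_iff val_append)
  then show "u \<in> Geo G X" "v \<in> Geo G X" using uv len_val_le[of u] len_val_le[of v]
    by (auto simp: Geo_iff)
qed

lemma finite_ball: "finite {g \<in> carrier G. len g \<le> n}"
proof (rule finite_subset)
  show "{g \<in> carrier G. len g \<le> n} \<subseteq> val ` {w. set w \<subseteq> letters \<and> length w \<le> n}"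
    using ex_shortest_word by (fastforce simp: in_lists_conv_set)
  show "finite (val ` {w. set w \<subseteq> letters \<and> length w \<le> n})"
    using finite_lists_length_le[OF finite_letters] by simp
qed

section \<open>The word metric and change of generators\<close>

abbreviation dist :: "'a \<Rightarrow> 'a \<Rightarrow> real" where "dist \<equiv> word_metric G X"

lemma dist_commute:
  assumes "x \<in> carrier G" "y \<in> carrier G"
  shows "dist x y = dist y x"
proof -
  have "inv (inv x \<otimes> y) = inv y \<otimes> x" using assms by (simp add: inv_mult_group)
  moreover have "len (inv (inv x \<otimes> y)) = len (inv x \<otimes> y)" using assms by (intro len_inv) simp
  ultimately show ?thesis unfolding word_metric_word_length by (simp only:)
qed

lemma dist_triangle:
  assumes "x \<in> carrier G" "y \<in> carrier G" "z \<in> carrier G"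
  shows "dist x z \<le> dist x y + dist y z"
proof -
  have "(inv x \<otimes> y) \<otimes> (inv y \<otimes> z) = inv x \<otimes> z"
    using assms by (simp add: m_assoc)
  then show ?thesis using len_mult_le[of "inv x \<otimes> y" "inv y \<otimes> z"] assms
    by (simp add: word_metric_word_length)
qed

lemma dist_left_mult:
  assumes "x \<in> carrier G" "y \<in> carrier G" "z \<in> carrier G"
  shows "dist (x \<otimes> y) (x \<otimes> z) = dist y z"
proof -
  have "inv (x \<otimes> y) \<otimes> (x \<otimes> z) = inv y \<otimes> z"
    using assms by (simp add: inv_mult_group m_assoc)
  then show ?thesis by (simp add: word_metric_word_length)
qed

lemma take_in_letters: "w \<in> Geo G X \<Longrightarrow> take i w \<in> lists letters"
  by (auto simp: Geo_iff dest: in_set_takeD)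

text \<open>The factor between two prefixes of a geodesic is again a geodesic, so reading the word
  is a path of unit speed.\<close>

lemma dist_prefixes:
  assumes "w \<in> Geo G X" "i \<le> length w" "j \<le> length w"
  shows "dist (val (take i w)) (val (take j w)) = \<bar>real i - real j\<bar>"
proof -
  have *: "dist (val (take i w)) (val (take j w)) = real j - real i"
    if "i \<le> j" "j \<le> length w" for i j
  proof -
    define v where "v = drop i (take j w)"
    have split: "take j w = take i w @ v" using that unfolding v_def
      by (metis append_take_drop_id min.absorb2 min.commute take_take)
    have "take j w \<in> Geo G X" using assms(1) Geo_append(1)[of "take j w" "drop j w"] by simp
    then have v: "v \<in> Geo G X" "take i w \<in> lists letters"
      using split Geo_append[of "take i w" v] by (auto simp: Geo_iff)
    then have "inv (val (take i w)) \<otimes> val (take j w) = val v"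
      by (simp add: split val_append Geo_iff)
    moreover have "len (val v) = j - i" using v that by (simp add: Geo_iff v_def)
    ultimately show ?thesis using that by (simp add: word_metric_word_length of_nat_diff)
  qed
  show ?thesis
  proof (cases "i \<le> j")
    case True
    with * assms show ?thesis by simp
  next
    case False
    with *[of j i] assms dist_commute take_in_letters show ?thesis by simp
  qed
qed

text \<open>Rewriting a shortest word letter by letter over \<open>Y\<close> stretches its length by
  a bounded factor. Exchanging the roles of the two sets gives the reverse inequality.\<close>

lemma bilipschitz:
  assumes "finitely_generated_group G Y"
  obtains K where "0 \<le> K"
    "\<And>x y. \<lbrakk>x \<in> carrier G; y \<in> carrier G\<rbrakk> \<Longrightarrow> word_metric G Y x y \<le> K * dist x y"
proof -
  interpret Y: finitely_generated_group G Y by fact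
  \<comment> \<open>The sum dominates each of its terms and needs no separate case for an empty
    alphabet.\<close>
  define K where "K = (\<Sum>a\<in>letters. Y.len a)"
  have K: "Y.len (val w) \<le> K * length w" if "w \<in> lists letters" for w
    using that
  proof (induction w)
    case (Cons a w)
    then have "Y.len a \<le> K" unfolding K_def using finite_letters by (intro member_le_sum) auto
    moreover have "Y.len (a \<otimes> val w) \<le> Y.len a + Y.len (val w)"
      using Cons letters_closed by (intro Y.len_mult_le) auto
    ultimately show ?case using Cons by auto
  qed simp
  have "word_metric G Y x y \<le> real K * dist x y" if xy: "x \<in> carrier G" "y \<in> carrier G" for x y
  proof -
    obtain w where w: "w \<in> lists letters" "val w = inv x \<otimes> y" "length w = len (inv x \<otimes> y)"
      using ex_shortest_word[of "inv x \<otimes> y"] xy by auto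
    then have "Y.len (inv x \<otimes> y) \<le> K * len (inv x \<otimes> y)" using K[OF w(1)] by simp
    then show ?thesis unfolding word_metric_word_length by (metis of_nat_le_iff of_nat_mult)
  qed
  then show thesis by (intro that[of "real K"]) auto
qed

text \<open>Translating the prefixes of a geodesic word for \<open>inv x \<otimes> y\<close> by
  \<open>x\<close> gives the required geodesic. Raising \<open>\<delta>\<close> to at least 1 only
  weakens the four-point inequality.\<close>

lemma discrete_hyperbolic_space:
  assumes "gromov_hyperbolic (carrier G) dist"
  shows "\<exists>\<delta>. discrete_hyperbolic_space (carrier G) dist \<delta>"
proof -
  obtain \<delta> where \<delta>: "\<And>e x y z. \<lbrakk>e \<in> carrier G; x \<in> carrier G; y \<in> carrier G; z \<in> carrier G\<rbrakk> \<Longrightarrow>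
      gromov_product dist e x z \<ge> min (gromov_product dist e x y) (gromov_product dist e y z) - \<delta>"
    using assms unfolding gromov_hyperbolic_def by blast
  have "discrete_hyperbolic_space (carrier G) dist (max \<delta> 1)"
  proof
    fix e x y z assume "e \<in> carrier G" "x \<in> carrier G" "y \<in> carrier G" "z \<in> carrier G"
    from \<delta>[OF this] show "min (gromov_product dist e x y) (gromov_product dist e y z) - max \<delta> 1
        \<le> gromov_product dist e x z" by linarith
  next
    fix x y assume xy: "x \<in> carrier G" "y \<in> carrier G"
    then obtain w where w: "w \<in> Geo G X" "val w = inv x \<otimes> y"
      using ex_Geo[of "inv x \<otimes> y"] by auto
    define g where "g i = x \<otimes> val (take i w)" for i
    have "g 0 = x" "g (length w) = y" using xy w by (auto simp: g_def)
    moreover have "g ` {..length w} \<subseteq> carrier G" using xy take_in_letters[OF w(1)] by (auto simp: g_def)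
    moreover have "dist (g i) (g j) = \<bar>real i - real j\<bar>" if "i \<le> length w" "j \<le> length w" for i j
      using dist_left_mult[OF xy(1)] take_in_letters[OF w(1)] dist_prefixes[OF w(1) that]
      by (simp add: g_def)
    ultimately show "\<exists>g n. g 0 = x \<and> g n = y \<and> g ` {..n} \<subseteq> carrier G \<and>
        (\<forall>i\<le>n. \<forall>j\<le>n. dist (g i) (g j) = \<bar>real i - real j\<bar>)" by blast
  qed (use dist_commute dist_triangle in \<open>auto simp: word_metric_word_length\<close>)
  then show ?thesis by blast
qed

section \<open>Fellow travelling and cone types\<close>

text \<open>Over the generating set \<open>Y\<close> with a hyperbolic metric, both paths are
  quasi-geodesics with common ends once the translate of \<open>w\<close> is prolonged to the ends
  of \<open>v\<close>. Stability gives some nearby point, and unit speed over \<open>X\<close>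
  forces its parameter to be nearly right. The identity as \<open>x\<close> serves cone types, a
  generator serves conjugates.\<close>

lemma fellow_travel:
  assumes "hyperbolic_group G"
  obtains k :: nat where "\<And>v w x i. \<lbrakk>v \<in> Geo G X; w \<in> Geo G X; x \<in> carrier G; len x \<le> 1;
      dist (val v) (x \<otimes> val w) \<le> 1; i \<le> length v\<rbrakk> \<Longrightarrow>
      dist (val (take i v)) (x \<otimes> val (take i w)) \<le> k"
proof -
  obtain Y where Y: "finite_generating_set G Y" "gromov_hyperbolic (carrier G) (word_metric G Y)"
    using assms unfolding hyperbolic_group_def by blast
  interpret Y: finitely_generated_group G Y by unfold_locales fact
  obtain \<delta> where "discrete_hyperbolic_space (carrier G) (word_metric G Y) \<delta>"
    using Y.discrete_hyperbolic_space Y(2) by blast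
  then interpret H: discrete_hyperbolic_space "carrier G" "word_metric G Y" \<delta> .
  obtain K where K: "0 \<le> K"
    "\<And>x y. \<lbrakk>x \<in> carrier G; y \<in> carrier G\<rbrakk> \<Longrightarrow> word_metric G Y x y \<le> K * dist x y"
    using bilipschitz[OF Y.finitely_generated_group_axioms] by blast
  obtain l where l: "0 \<le> l"
    "\<And>x y. \<lbrakk>x \<in> carrier G; y \<in> carrier G\<rbrakk> \<Longrightarrow> dist x y \<le> l * word_metric G Y x y"
    using Y.bilipschitz[OF finitely_generated_group_axioms] by blast
  obtain B where B: "0 \<le> B"
    "\<And>f N f' N' j. \<lbrakk>H.quasi_geodesic K l 4 f N; H.quasi_geodesic K l 4 f' N'; f 0 = f' 0;
       f N = f' N'; j \<le> N\<rbrakk> \<Longrightarrow> \<exists>i\<le>N'. word_metric G Y (f j) (f' i) \<le> B"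
    using H.quasi_geodesics_close[OF K(1) l(1), of 4] by (metis zero_le_numeral)
  have quasi: "H.quasi_geodesic K l 4 f N"
    if f: "\<And>i. i \<le> N \<Longrightarrow> f i \<in> carrier G" "\<And>i. i < N \<Longrightarrow> dist (f i) (f (Suc i)) \<le> 1"
      "\<And>i j. \<lbrakk>i \<le> N; j \<le> N\<rbrakk> \<Longrightarrow> \<bar>real i - real j\<bar> \<le> dist (f i) (f j) + 4" for f N
    unfolding H.quasi_geodesic_def
  proof (intro conjI allI impI)
    show "f ` {..N} \<subseteq> carrier G" using f(1) by auto
    show "word_metric G Y (f i) (f (Suc i)) \<le> K" if "i < N" for i
      using K(2)[of "f i" "f (Suc i)"] mult_left_mono[OF f(2)[OF that] K(1)] f(1) that by simp
    show "\<bar>real i - real j\<bar> \<le> l * word_metric G Y (f i) (f j) + 4" if "i \<le> N" "j \<le> N" for i j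
      using l(2)[of "f i" "f j"] f(1) f(3)[OF that] that by force
  qed
  \<comment> \<open>The bound adds \<open>l * B + 1\<close>, the distance to some
    \<open>q (m i)\<close>, and \<open>l * B + 2\<close>, the cost of moving the parameter from
    \<open>m i\<close> to \<open>j\<close>.\<close>
  have "dist (val (take j v)) (x \<otimes> val (take j w)) \<le> nat \<lceil>2 * (l * B) + 3\<rceil>"
    if v: "v \<in> Geo G X" and w: "w \<in> Geo G X" and x: "x \<in> carrier G" "len x \<le> 1"
      and ends: "dist (val v) (x \<otimes> val w) \<le> 1" and j: "j \<le> length v" for v w x j
  proof -
    define p where "p i = val (take i v)" for i
    define q where "q i = x \<otimes> val (take i w)" for i
    have p: "p i \<in> carrier G" for i using take_in_letters[OF v] by (simp add: p_def)
    have q: "q i \<in> carrier G" for i using take_in_letters[OF w] x by (simp add: q_def)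
    have pp: "dist (p i) (p j) = \<bar>real i - real j\<bar>" if "i \<le> length v" "j \<le> length v" for i j
      using dist_prefixes[OF v that] by (simp add: p_def)
    have qq: "dist (q i) (q j) = \<bar>real i - real j\<bar>" if "i \<le> length w" "j \<le> length w" for i j
      using dist_prefixes[OF w that] dist_left_mult x(1) take_in_letters[OF w] by (simp add: q_def)
    have start: "dist (p 0) (q 0) \<le> 1" using x by (simp add: p_def q_def word_metric_word_length)
    have finish: "dist (q (length w)) (p (length v)) \<le> 1"
      using ends dist_commute[OF p[of "length v"] q[of "length w"]] by (simp add: p_def q_def)
    \<comment> \<open>The path \<open>f\<close> visits \<open>p 0\<close>, then \<open>q 0\<close>
      up to \<open>q (length w)\<close>, then \<open>p (length v)\<close>: one extra vertex at each
      end of the translate. \<open>m i\<close> is the index of a point of \<open>q\<close> near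
      \<open>f i\<close>.\<close>
    define N where "N = length w + 2"
    define f where "f i = (if i = 0 then p 0 else if i < N then q (i - 1) else p (length v))" for i
    define m where "m i = min (i - 1) (length w)" for i
    have f: "f i \<in> carrier G" for i using p q by (simp add: f_def)
    have m: "m i \<le> length w" "i \<le> N \<Longrightarrow> \<bar>real i - real (m i) - 1\<bar> \<le> 1" for i
      by (auto simp: m_def N_def)
    have fq: "dist (f i) (q (m i)) \<le> 1" if i: "i \<le> N" for i
    proof -
      consider "i = 0" | "0 < i" "i < N" | "i = N" "0 < N" using i
        by (metis le_neq_implies_less neq0_conv)
      then show ?thesis
      proof cases
        case 1
        then show ?thesis using start by (simp add: f_def m_def)
      next
        case 2
        then have "m i = i - 1" by (simp add: m_def N_def)
        then show ?thesis using 2 q by (simp add: f_def word_metric_word_length)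
      next
        case 3
        then have "m i = length w" by (simp add: m_def N_def)
        then show ?thesis using 3 finish dist_commute p q by (simp add: f_def)
      qed
    qed
    have "H.quasi_geodesic K l 4 p (length v)"
      by (rule quasi) (use p pp in auto)
    moreover have "H.quasi_geodesic K l 4 f N"
    proof (rule quasi)
      show "dist (f i) (f (Suc i)) \<le> 1" if i: "i < N" for i
      proof -
        consider "i = 0" | "0 < i" "Suc i < N" | "Suc i = N" "0 < i"
          using i by linarith
        then show ?thesis
        proof cases
          case 1
          then show ?thesis using start by (simp add: f_def N_def)
        next
          case 2
          then show ?thesis using qq[of "i - 1" i] by (simp add: f_def N_def)
        next
          case 3
          then show ?thesis using finish by (simp add: f_def N_def)
        qed
      qed
      show "\<bar>real i - real k\<bar> \<le> dist (f i) (f k) + 4" if "i \<le> N" "k \<le> N" for i k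
      proof -
        \<comment> \<open>Replacing \<open>f i\<close> by \<open>q (m i)\<close> costs at most 1 in
          distance and, up to a common shift, at most 1 in the parameter. Doing so at both points
          gives the additive constant 4.\<close>
        have "dist (q (m i)) (q (m k)) \<le> dist (q (m i)) (f i) + dist (f i) (f k) + dist (f k) (q (m k))"
          using dist_triangle[OF q[of "m i"] f[of i] q[of "m k"]]
            dist_triangle[OF f[of i] f[of k] q[of "m k"]] by linarith
        then show ?thesis
          using qq[OF m(1)[of i] m(1)[of k]] fq[OF that(1)] fq[OF that(2)] m(2)[OF that(1)]
            m(2)[OF that(2)] dist_commute[OF q[of "m i"] f[of i]] by linarith
      qed
    qed (use f in auto)
    moreover have "p 0 = f 0" "p (length v) = f N" by (simp_all add: f_def N_def)
    ultimately obtain i where i: "i \<le> N" "word_metric G Y (p j) (f i) \<le> B"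
      using B(2)[of p "length v" f N j] j by auto
    have "dist (p j) (f i) \<le> l * B"
      using l(2)[OF p[of j] f[of i]] mult_left_mono[OF i(2) l(1)] by linarith
    then have close: "dist (p j) (q (m i)) \<le> l * B + 1"
      using dist_triangle[OF p[of j] f[of i] q[of "m i"]] fq[OF i(1)] by linarith
    text \<open>Both paths are parametrised by arc length, so the parameters nearly agree as well.\<close>
    have "\<bar>real j - real (m i)\<bar> \<le> l * B + 2"
    proof -
      have "dist (p 0) (p j) = real j" "dist (q 0) (q (m i)) = real (m i)"
        using pp[of 0 j] qq[of 0 "m i"] j m(1)[of i] by auto
      then show ?thesis
        using close start dist_triangle[OF p[of 0] q[of "m i"] p[of j]]
          dist_triangle[OF p[of 0] q[of 0] q[of "m i"]] dist_triangle[OF q[of 0] p[of 0] q[of "m i"]]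
          dist_triangle[OF p[of 0] p[of j] q[of "m i"]]
          dist_commute[OF p[of j] q[of "m i"]] dist_commute[OF p[of 0] q[of 0]] by linarith
    qed
    \<comment> \<open>\<open>j\<close> may exceed the length of \<open>w\<close>, in which case
      \<open>take j w\<close> is all of \<open>w\<close>.\<close>
    moreover have "q j = q (min j (length w))" by (simp add: q_def min_def)
    then have "dist (q (m i)) (q j) \<le> \<bar>real j - real (m i)\<bar>"
      using qq[OF m(1)[of i], of "min j (length w)"] m(1)[of i] by (auto simp: min_def split: if_splits)
    ultimately have "dist (p j) (q j) \<le> 2 * (l * B) + 3"
      using close dist_triangle[OF p[of j] q[of "m i"] q[of j]] by linarith
    then show ?thesis unfolding p_def q_def by linarith
  qed
  then show thesis by (rule that)
qed

text \<open>
  Cannon's argument: a shortcut for the word \<open>u' v a\<close> fellow travels \<open>u' v\<close>, so when \<open>u'\<close>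
  has been read it is at some \<open>u' h\<close> with \<open>h\<close> in a fixed ball and \<open>u' h\<close> no longer than \<open>u'\<close>.
  The same \<open>h\<close> then gives a shortcut for \<open>u v a\<close>.
\<close>
lemma cone_type_mono:
  assumes k: "\<And>v w x i. \<lbrakk>v \<in> Geo G X; w \<in> Geo G X; x \<in> carrier G; len x \<le> 1;
      dist (val v) (x \<otimes> val w) \<le> 1; i \<le> length v\<rbrakk> \<Longrightarrow>
      dist (val (take i v)) (x \<otimes> val (take i w)) \<le> real k"
    and u': "u' \<in> Geo G X"
    and level: "\<And>h. \<lbrakk>h \<in> carrier G; len h \<le> k; len (val u' \<otimes> h) \<le> length u'\<rbrakk> \<Longrightarrow>
      len (val u \<otimes> h) \<le> length u"
    and uv: "u @ v \<in> Geo G X"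
  shows "u' @ v \<in> Geo G X"
  using uv
proof (induction v rule: rev_induct)
  case Nil
  then show ?case using u' by simp
next
  case (snoc a v)
  have L: "u \<in> lists letters" "u' \<in> lists letters" "v \<in> lists letters" "a \<in> letters" "a \<in> carrier G"
    using snoc.prems u' letters_closed by (auto simp: Geo_iff)
  have IH: "u' @ v \<in> Geo G X" using snoc Geo_append(1)[of "u @ v" "[a]"] by simp
  have uva: "len (val u \<otimes> (val v \<otimes> a)) = length u + length v + 1"
    using snoc.prems L by (simp add: Geo_iff val_append)
  define g where "g = val u' \<otimes> (val v \<otimes> a)"
  have g: "g \<in> carrier G" "val (u' @ v) \<otimes> a = g" "val (u' @ v @ [a]) = g"
    using L by (simp_all add: g_def val_append m_assoc)
  show ?case
  proof (rule ccontr)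
    assume "u' @ v @ [a] \<notin> Geo G X"
    then have short: "len g \<le> length u' + length v"
      using len_val_le[of "u' @ v @ [a]"] L g by (simp add: Geo_iff)
    obtain w where w: "w \<in> Geo G X" "val w = g" "length w = len g" using ex_Geo[OF g(1)] by blast
    \<comment> \<open>The shortcut is cut after \<open>length u'\<close> letters; if it is shorter
      than that, \<open>w2\<close> is empty and the estimates still hold.\<close>
    define w1 w2 where "w1 = take (length u') w" and "w2 = drop (length u') w"
    have "w1 @ w2 = w" by (simp add: w1_def w2_def)
    moreover from this have wl: "w1 \<in> lists letters" "w2 \<in> lists letters"
      using w(1) by (auto simp: Geo_iff)
    ultimately have w12: "val w1 \<otimes> val w2 = g" using val_append[OF wl] w(2) by simp
    define h where "h = inv (val u') \<otimes> val w1"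
    have h: "h \<in> carrier G" "val u' \<otimes> h = val w1"
      using wl L by (simp_all add: h_def)
    \<comment> \<open>\<open>w\<close> and \<open>u' @ v\<close> end one letter apart, so fellow
      travelling applies with the identity as translation.\<close>
    have "len a \<le> 1" using len_val_le[of "[a]"] L by simp
    moreover have "inv (val (u' @ v)) \<otimes> (\<one> \<otimes> val w) = a"
      using L w(2) unfolding g(2)[symmetric] by simp
    ultimately have "dist (val (u' @ v)) (\<one> \<otimes> val w) \<le> 1"
      by (simp add: word_metric_word_length)
    from k[OF IH w(1) one_closed _ this, of "length u'"] have "len h \<le> k"
      using wl by (simp add: h_def w1_def word_metric_word_length)
    moreover have "len (val u' \<otimes> h) \<le> length u'"
      using len_val_le[OF wl(1)] h by (simp add: w1_def)
    ultimately have "len (val u \<otimes> h) \<le> length u" using level h by blast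
    moreover have "len (val w2) \<le> length v"
      using len_val_le[OF wl(2)] w(3) short by (simp add: w2_def)
    moreover have "len ((val u \<otimes> h) \<otimes> val w2) \<le> len (val u \<otimes> h) + len (val w2)"
      using L wl h by (intro len_mult_le) auto
    \<comment> \<open>Cancelling \<open>val u'\<close> shows that \<open>h\<close> followed by
      \<open>w2\<close> has the same value as \<open>v\<close> followed by \<open>a\<close>. After
      \<open>u\<close> this route is too short by one letter.\<close>
    moreover have "val u' \<otimes> (h \<otimes> val w2) = val u' \<otimes> (val v \<otimes> a)"
      using h wl w12 L by (simp add: g_def flip: m_assoc[of "val u'" h])
    then have "h \<otimes> val w2 = val v \<otimes> a" using h wl L by simp
    then have "(val u \<otimes> h) \<otimes> val w2 = val u \<otimes> (val v \<otimes> a)" using h wl L by (simp add: m_assoc)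
    ultimately show False using uva by simp
  qed
qed

section \<open>Central elements\<close>

text \<open>Centrality, tested on the generators only, so that finitely many conjugates decide
  it.\<close>

definition commutes_with_gens :: "'a \<Rightarrow> bool" where
  "commutes_with_gens g \<longleftrightarrow> (\<forall>x\<in>X. g \<otimes> x = x \<otimes> g)"

text \<open>The elements commuting with \<open>g\<close> form a subgroup, which is everything once
  it contains \<open>X\<close>.\<close>

lemma commutes_with_gens_iff:
  assumes g: "g \<in> carrier G"
  shows "commutes_with_gens g \<longleftrightarrow> (\<forall>x\<in>carrier G. g \<otimes> x = x \<otimes> g)"
proof
  assume c: "commutes_with_gens g"
  show "\<forall>x\<in>carrier G. g \<otimes> x = x \<otimes> g"
  proof
    fix x assume "x \<in> carrier G"
    then have "x \<in> generate G X" using fin_gen by (simp add: finite_generating_set_def)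
    then have "x \<in> carrier G \<and> g \<otimes> x = x \<otimes> g"
    proof (induction x rule: generate.induct)
      case (inv h)
      then have h: "h \<in> carrier G" "g \<otimes> h = h \<otimes> g" using c X_closed
        by (auto simp: commutes_with_gens_def)
      then have "inv h \<otimes> (g \<otimes> h) \<otimes> inv h = inv h \<otimes> (h \<otimes> g) \<otimes> inv h" by simp
      then have "inv h \<otimes> g = g \<otimes> inv h" using h(1) g
        by (simp add: m_assoc)
      with h show ?case by simp
    next
      case (eng x y)
      then show ?case using g by (metis m_assoc m_closed)
    qed (use g c X_closed in \<open>auto simp: commutes_with_gens_def\<close>)
    then show "g \<otimes> x = x \<otimes> g" ..
  qed
qed (use X_closed in \<open>auto simp: commutes_with_gens_def\<close>)

text \<open>\<open>g\<close> lies in its own class, so a second element exists exactly when some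
  conjugate differs from \<open>g\<close>.\<close>

lemma has_several_conjugates_iff:
  assumes g: "g \<in> carrier G"
  shows "has_several_conjugates G g \<longleftrightarrow> \<not> commutes_with_gens g"
proof -
  have conj: "x \<otimes> g \<otimes> inv x = g \<longleftrightarrow> g \<otimes> x = x \<otimes> g" if "x \<in> carrier G" for x
    using that g by (metis inv_solve_right m_closed)
  have "g \<in> conj_class G g" using g unfolding conj_class_def by (force intro: exI[of _ "\<one>"])
  then have "has_several_conjugates G g \<longleftrightarrow> (\<exists>x\<in>carrier G. x \<otimes> g \<otimes> inv x \<noteq> g)"
    unfolding has_several_conjugates_def conj_class_def by (smt (verit) mem_Collect_eq)
  then show ?thesis using commutes_with_gens_iff[OF g] conj by auto
qed

section \<open>Residuals and regularity\<close>

text \<open>\<open>level u\<close> determines the geodesic continuations of \<open>u\<close> through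
  \<open>cone_type_mono\<close>, and \<open>conj u\<close> decides which of them are central. Both
  range over finite sets as soon as \<open>u\<close> has a central geodesic continuation.\<close>

lemma finite_residuals_central_Geo:
  assumes "hyperbolic_group G"
  shows "finite ((\<lambda>u. {v. u @ v \<in> Geo G X \<and> commutes_with_gens (val (u @ v))}) ` lists letters)"
    (is "finite (?r ` _)")
proof -
  obtain k :: nat where k: "\<And>v w x i. \<lbrakk>v \<in> Geo G X; w \<in> Geo G X; x \<in> carrier G; len x \<le> 1;
      dist (val v) (x \<otimes> val w) \<le> 1; i \<le> length v\<rbrakk> \<Longrightarrow>
      dist (val (take i v)) (x \<otimes> val (take i w)) \<le> k"
    using fellow_travel[OF assms] by blast
  define B where "B = {g \<in> carrier G. len g \<le> k}"
  define level where "level u = {h \<in> B. len (val u \<otimes> h) \<le> length u}" for u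
  \<comment> \<open>Restricting the function to \<open>X\<close> makes it an element of the finite
    extensional function space used below.\<close>
  define conj where "conj u = (\<lambda>x\<in>X. inv (val u) \<otimes> (x \<otimes> val u))" for u
  \<comment> \<open>Words outside \<open>U\<close> share the empty residual; the bound on the
    conjugates relies on a central continuation.\<close>
  define U where "U = {u \<in> lists letters. ?r u \<noteq> {}}"
  have U: "u \<in> Geo G X" "u \<in> lists letters" if "u \<in> U" for u
    using that Geo_append(1) by (auto simp: U_def Geo_iff)
  have "finite (?r ` U)"
  proof (rule finite_image_if_determined)
    have "finite X" using fin_gen by (simp add: finite_generating_set_def)
    moreover have "finite B" unfolding B_def by (rule finite_ball)
    ultimately show "finite (Pow B \<times> (X \<rightarrow>\<^sub>E B))" by (intro finite_cartesian_product finite_PiE) auto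
    show "(\<lambda>u. (level u, conj u)) ` U \<subseteq> Pow B \<times> (X \<rightarrow>\<^sub>E B)"
    proof clarify
      fix u assume "u \<in> U"
      then obtain v where v: "u @ v \<in> Geo G X" "commutes_with_gens (val (u @ v))"
        by (auto simp: U_def)
      have "inv (val u) \<otimes> (x \<otimes> val u) \<in> B" if "x \<in> X" for x
      proof -
        have x: "x \<in> carrier G" "len x \<le> 1" using that X_closed len_X_le by auto
        have c: "val (u @ v) \<in> carrier G" using v by (simp add: Geo_iff)
        \<comment> \<open>Centrality makes \<open>u @ v\<close> and its translate by
          \<open>x\<close> end at distance \<open>len x\<close>. Fellow travelling, at the moment
          when \<open>u\<close> has been read, bounds the conjugate.\<close>
        have "x \<otimes> val (u @ v) = val (u @ v) \<otimes> x"
          using v(2) that by (simp add: commutes_with_gens_def)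
        then have "inv (val (u @ v)) \<otimes> (x \<otimes> val (u @ v)) = x" using x c by simp
        then have "dist (val (u @ v)) (x \<otimes> val (u @ v)) \<le> 1"
          using x by (simp add: word_metric_word_length)
        from k[OF v(1) v(1) x this, of "length u"] show ?thesis
          using x U[OF \<open>u \<in> U\<close>] by (simp add: B_def word_metric_word_length)
      qed
      then show "level u \<in> Pow B \<and> conj u \<in> X \<rightarrow>\<^sub>E B" by (auto simp: level_def conj_def)
    qed
    have mono: "?r u \<subseteq> ?r u'" if u: "u \<in> U" "u' \<in> U" and eq: "(level u, conj u) = (level u', conj u')"
      for u u'
    proof safe
      fix v assume v: "u @ v \<in> Geo G X" "commutes_with_gens (val (u @ v))"
      note L = U[OF u(1)] U[OF u(2)]
      have vl: "v \<in> lists letters" using v by (simp add: Geo_iff)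
      have "len (val u \<otimes> h) \<le> length u"
        if "h \<in> carrier G" "len h \<le> k" "len (val u' \<otimes> h) \<le> length u'" for h
      proof -
        have "h \<in> level u'" using that by (simp add: level_def B_def)
        then show ?thesis using eq by (auto simp: level_def)
      qed
      from cone_type_mono[OF k U(1)[OF u(2)] this v(1)] show "u' @ v \<in> Geo G X" by blast
      \<comment> \<open>After cancelling \<open>val t\<close> the condition depends on
        \<open>t\<close> only through the conjugate of \<open>x\<close>.\<close>
      have *: "val (t @ v) \<otimes> x = x \<otimes> val (t @ v) \<longleftrightarrow>
          val v \<otimes> x = inv (val t) \<otimes> (x \<otimes> val t) \<otimes> val v"
        if "t \<in> lists letters" "x \<in> carrier G" for t x
      proof -
        have "x \<otimes> val (t @ v) = val t \<otimes> (inv (val t) \<otimes> (x \<otimes> val t) \<otimes> val v)"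
          using that vl by (simp add: val_append m_assoc)
        moreover have "val (t @ v) \<otimes> x = val t \<otimes> (val v \<otimes> x)"
          using that vl by (simp add: val_append m_assoc)
        ultimately show ?thesis using that vl by (simp only: Units_l_cancel Units_eq m_closed inv_closed val_closed)
      qed
      have conj_eq: "inv (val u) \<otimes> (x \<otimes> val u) = inv (val u') \<otimes> (x \<otimes> val u')" if "x \<in> X" for x
      proof -
        have "conj u x = conj u' x" using eq by simp
        then show ?thesis using that by (simp add: conj_def)
      qed
      show "commutes_with_gens (val (u' @ v))"
        unfolding commutes_with_gens_def
      proof
        fix x assume x: "x \<in> X"
        then have xc: "x \<in> carrier G" using X_closed by auto
        have "val (u @ v) \<otimes> x = x \<otimes> val (u @ v)"
          using v(2) x by (simp add: commutes_with_gens_def)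
        then show "val (u' @ v) \<otimes> x = x \<otimes> val (u' @ v)"
          unfolding *[OF L(2) xc] *[OF L(4) xc] conj_eq[OF x] .
      qed
    qed
    show "?r u = ?r u'" if "u \<in> U" "u' \<in> U" "(level u, conj u) = (level u', conj u')" for u u'
      using mono[OF that] mono[OF that(2,1) that(3)[symmetric]] by (rule subset_antisym)
  qed
  moreover have "?r ` lists letters \<subseteq> insert {} (?r ` U)" by (auto simp: U_def)
  ultimately show ?thesis by (meson finite_insert finite_subset)
qed

text \<open>A central element is alone in its \<open>UConj\<close> class, so all its geodesics
  qualify. A noncentral one fails to commute with some generator, which is then noncentral itself
  and has length at most 1, so no longer word is minimal.\<close>

lemma UConjGeo_long_iff:
  assumes "1 < length w"
  shows "w \<in> UConjGeo G X \<longleftrightarrow> w \<in> Geo G X \<and> commutes_with_gens (val w)"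
proof (cases "w \<in> Geo G X")
  case True
  then have w: "val w \<in> carrier G" by (simp add: Geo_iff)
  show ?thesis
  proof (cases "commutes_with_gens (val w)")
    case c: True
    then have "val w = val u" if "(val w, val u) \<in> UConj G" for u
      using that has_several_conjugates_iff[OF w] by (auto simp: UConj_def)
    then have "length w \<le> length u" if "u \<in> Geo G X" "(val w, val u) \<in> UConj G" for u
      using that True by (metis Geo_iff order_refl)
    then show ?thesis using True c by (auto simp: UConjGeo_def)
  next
    case False
    then obtain x where x: "x \<in> X" "val w \<otimes> x \<noteq> x \<otimes> val w" by (auto simp: commutes_with_gens_def)
    have xc: "x \<in> carrier G" using x X_closed by auto
    have "\<not> commutes_with_gens x" using x commutes_with_gens_iff[OF xc] w by metis
    then have "(val w, x) \<in> UConj G"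
      using False w xc by (simp add: UConj_def has_several_conjugates_iff)
    moreover obtain u where "u \<in> Geo G X" "val u = x" "length u \<le> 1"
      using ex_Geo[OF xc] len_X_le[OF x(1)] by auto
    ultimately have "w \<notin> UConjGeo G X" using assms by (force simp: UConjGeo_def)
    then show ?thesis using False by simp
  qed
qed (simp add: UConjGeo_def)

text \<open>Prefixes with at least two letters have the same residuals as for the central geodesics;
  the remaining prefixes are finite in number.\<close>

lemma regular_UConjGeo:
  assumes "hyperbolic_group G"
  shows "regular_language letters (UConjGeo G X)"
proof (rule regular_language_if_finite_residuals)
  let ?c = "\<lambda>u. {v. u @ v \<in> Geo G X \<and> commutes_with_gens (val (u @ v))}"
  let ?r = "\<lambda>u. {v. u @ v \<in> UConjGeo G X}"
  let ?S = "{u. set u \<subseteq> letters \<and> length u \<le> 1}"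
  have "?r u = ?c u" if "1 < length u" for u
    using UConjGeo_long_iff[of "u @ v" for v] that by simp
  then have "?r ` lists letters \<subseteq> ?c ` lists letters \<union> ?r ` ?S"
    by (force simp: in_lists_conv_set not_less)
  moreover have "finite (?r ` ?S)" using finite_lists_length_le[OF finite_letters] by simp
  ultimately show "finite (?r ` lists letters)"
    using finite_residuals_central_Geo[OF assms] by (meson finite_UnI finite_subset)
qed (auto simp: finite_letters UConjGeo_def Geo_iff)

end

theorem proposition5p3:
  fixes G :: "('a, 'b) monoid_scheme" and X :: "'a set"
  assumes "hyperbolic_group G"
    and "finite_generating_set G X"
  shows "regular_language (sym_gens G X) (UConjGeo G X)"
proof -
  interpret group G using assms(1) by (simp add: hyperbolic_group_def)
  interpret finitely_generated_group G X by unfold_locales fact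
  show ?thesis by (rule regular_UConjGeo) fact
qed

end
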